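(* Let $H$ be a complex Hilbert space and let $A,B\in B(H)$ be positive and commuting. Then \[0\leq A\leq B\Longrightarrow A^{\alpha}\leq B^{\alpha}\] for any real $\alpha\in(0,\infty)$.
   Context: $B(H)$ denotes the bounded linear operators on $H$. $A\in B(H)$ is positive ($A\geq 0$) if $\langle Ax,x\rangle\geq 0$ for all $x\in H$, and $A\leq B$ means $B-A\geq 0$. For $A\geq 0$ and real $\alpha>0$, $A^{\alpha}$ is defined by the continuous functional calculus of positive operators. *)

theory Defs
  imports "HOL-Analysis.Analysis" "HOL-Computational_Algebra.Polynomial"
begin

class complex_vector = real_vector +
  fixes scaleC :: "complex \<Rightarrow> 'a \<Rightarrow> 'a" (infixr "*\<^sub>C" 75)
  assumes scaleC_add_right: "c *\<^sub>C (x + y) = c *\<^sub>C x + c *\<^sub>C y"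
    and scaleC_add_left: "(c + d) *\<^sub>C x = c *\<^sub>C x + d *\<^sub>C x"
    and scaleC_scaleC: "c *\<^sub>C d *\<^sub>C x = (c * d) *\<^sub>C x"
    and scaleR_scaleC: "r *\<^sub>R x = complex_of_real r *\<^sub>C x"

text \<open>The inner product is linear in the first argument. Its real part is the real inner
  product of the underlying real space, so positive definiteness and the relation with the
  norm are inherited from class \<^class>\<open>real_inner\<close>; see the two lemmas below.\<close>

class complex_inner = complex_vector + real_inner +
  fixes cinner :: "'a \<Rightarrow> 'a \<Rightarrow> complex"
  assumes cinner_commute: "cinner x y = cnj (cinner y x)"
    and cinner_add_left: "cinner (x + y) z = cinner x z + cinner y z"
    and cinner_scaleC_left: "cinner (c *\<^sub>C x) y = c * cinner x y"
    and inner_eq_Re_cinner: "inner x y = Re (cinner x y)"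

lemma cinner_self: "cinner x x = complex_of_real ((norm x)\<^sup>2)"
  for x :: "'a::complex_inner"
proof (rule complex_eqI)
  show "Re (cinner x x) = Re (complex_of_real ((norm x)\<^sup>2))"
    by (simp add: power2_norm_eq_inner inner_eq_Re_cinner)
  have "Im (cinner x x) = - Im (cinner x x)"
    by (subst cinner_commute) simp
  then show "Im (cinner x x) = Im (complex_of_real ((norm x)\<^sup>2))"
    by simp
qed

lemma cinner_self_eq_0_iff: "cinner x x = 0 \<longleftrightarrow> x = 0"
  for x :: "'a::complex_inner"
  by (simp add: cinner_self)

class complex_hilbert = complex_inner + complete_space

instantiation complex :: complex_hilbert
begin

definition scaleC_complex :: "complex \<Rightarrow> complex \<Rightarrow> complex"
  where "scaleC_complex c x = c * x"

definition cinner_complex :: "complex \<Rightarrow> complex \<Rightarrow> complex"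
  where "cinner_complex x y = x * cnj y"

instance
  by standard
    (simp_all add: scaleC_complex_def cinner_complex_def inner_complex_def scaleR_conv_of_real
      algebra_simps)

end

text \<open>The space $B(H)$. The type \<^typ>\<open>'a \<Rightarrow>\<^sub>L 'a\<close> consists of the bounded real-linear operators,
  with the operator norm.\<close>

definition bounded_ops :: "('a::complex_hilbert \<Rightarrow>\<^sub>L 'a) set"
  where "bounded_ops = {A. \<forall>c x. blinfun_apply A (c *\<^sub>C x) = c *\<^sub>C blinfun_apply A x}"

definition positive_op :: "('a::complex_hilbert \<Rightarrow>\<^sub>L 'a) \<Rightarrow> bool"
  where "positive_op A \<longleftrightarrow> (\<forall>x. cinner (blinfun_apply A x) x \<in> \<real>\<^sub>\<ge>\<^sub>0)"

definition op_le :: "('a::complex_hilbert \<Rightarrow>\<^sub>L 'a) \<Rightarrow> ('a \<Rightarrow>\<^sub>L 'a) \<Rightarrow> bool" (infix "\<le>\<^sub>o\<^sub>p" 50)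
  where "A \<le>\<^sub>o\<^sub>p B \<longleftrightarrow> positive_op (B - A)"

definition op_spectrum :: "('a::complex_hilbert \<Rightarrow>\<^sub>L 'a) \<Rightarrow> complex set"
  where "op_spectrum A = {z. \<not> (\<exists>S \<in> bounded_ops. \<forall>x.
    blinfun_apply S (blinfun_apply A x - z *\<^sub>C x) = x \<and>
    blinfun_apply A (blinfun_apply S x) - z *\<^sub>C blinfun_apply S x = x)}"

definition op_poly :: "real poly \<Rightarrow> ('a::complex_hilbert \<Rightarrow>\<^sub>L 'a) \<Rightarrow> 'a \<Rightarrow>\<^sub>L 'a"
  where "op_poly p A = (\<Sum>i\<le>degree p. coeff p i *\<^sub>R ((\<lambda>T. A o\<^sub>L T) ^^ i) id_blinfun)"

text \<open>Continuous functional calculus of a self-adjoint operator for real functions: $f(A)$ is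
  the norm limit of $p_n(A)$ whenever the polynomials $p_n$ converge to $f$ uniformly on the
  spectrum. As the spectrum is real, it is enough to consider its real points. For continuous
  $f$ such $p_n$ exist by the Weierstrass theorem, and since the norm of $p(A)$ is the supremum
  of $|p|$ over the spectrum, the limit exists and does not depend on their choice.\<close>

definition cont_fun_calc :: "(real \<Rightarrow> real) \<Rightarrow> ('a::complex_hilbert \<Rightarrow>\<^sub>L 'a) \<Rightarrow> 'a \<Rightarrow>\<^sub>L 'a"
  where "cont_fun_calc f A = (THE T. \<exists>p :: nat \<Rightarrow> real poly.
    uniform_limit {t. complex_of_real t \<in> op_spectrum A} (\<lambda>n. poly (p n)) f sequentially \<and>
    (\<lambda>n. op_poly (p n) A) \<longlonglongrightarrow> T)"

definition op_powr :: "('a::complex_hilbert \<Rightarrow>\<^sub>L 'a) \<Rightarrow> real \<Rightarrow> 'a \<Rightarrow>\<^sub>L 'a"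
  where "op_powr A \<alpha> = cont_fun_calc (\<lambda>t. t powr \<alpha>) A"

end

(* Polynomials p_n with p_n' = r_n^2 approximate t^\<alpha> uniformly on an interval containing both
   spectra. As A commutes with D = B - A, the derivative of <p_n(A + s D) x, x> in s is
   <D r_n(A + s D) x, r_n(A + s D) x> >= 0, so p_n(A) <= p_n(B), and the order passes to the limit.
   That p_n(A) converges to A^\<alpha> needs the bound of |p(A)| by the supremum of |p| over the real
   spectrum: p^2 - |p(A)|^2 at the self-adjoint A is not bounded below, so one of its factors over
   the reals is not, and this factor can only be linear with its root in the spectrum. *)

theory Submission
  imports Defs "HOL-Computational_Algebra.Fundamental_Theorem_Algebra"
begin

text \<open>Operators into a Banach space form a complete normed space. This completeness supplies
  the limit that defines the functional calculus.\<close>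

instance complex_hilbert \<subseteq> banach ..

section \<open>Polynomials in an operator\<close>

lemma op_poly_0 [simp]: "op_poly 0 A = 0"
  by (simp add: op_poly_def)

text \<open>This Horner recursion makes induction over polynomials available for everything below.
  The case \<open>p = 0\<close> is separate because \<open>pCons a 0\<close> has degree 0, so the
  index shift in the sum fails there.\<close>

lemma op_poly_pCons [simp]: "op_poly (pCons a p) A = a *\<^sub>R id_blinfun + (A o\<^sub>L op_poly p A)"
proof (cases "p = 0")
  case True
  then show ?thesis by (cases "a = 0") (simp_all add: op_poly_def)
next
  case False
  have "op_poly (pCons a p) A = a *\<^sub>R id_blinfun
      + (\<Sum>i\<le>degree p. coeff p i *\<^sub>R (A o\<^sub>L ((\<lambda>T. A o\<^sub>L T) ^^ i) id_blinfun))"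
    unfolding op_poly_def using False
    by (simp add: sum.atMost_Suc_shift del: sum.atMost_Suc)
  also have "\<dots> = a *\<^sub>R id_blinfun + (A o\<^sub>L op_poly p A)"
    by (intro blinfun_eqI)
      (simp add: op_poly_def blinfun.bilinear_simps blinfun.sum_left blinfun.sum_right)
  finally show ?thesis .
qed

lemma op_poly_add: "op_poly (p + q) A = op_poly p A + op_poly q A"
  by (induction p q rule: poly_induct2)
    (auto intro!: blinfun_eqI simp: blinfun.bilinear_simps algebra_simps)

lemma op_poly_smult: "op_poly (smult c p) A = c *\<^sub>R op_poly p A"
  by (induction p)
    (auto intro!: blinfun_eqI simp: blinfun.bilinear_simps algebra_simps)

lemma op_poly_diff: "op_poly (p - q) A = op_poly p A - op_poly q A"
  using op_poly_add[of p "- q" A] op_poly_smult[of "- 1" q A] by simp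

lemma op_poly_mult: "op_poly (p * q) A = op_poly p A o\<^sub>L op_poly q A"
  by (induction p)
    (auto intro!: blinfun_eqI simp: blinfun.bilinear_simps op_poly_add op_poly_smult)

lemma blinfun_commute_apply: "S o\<^sub>L T = T o\<^sub>L S \<Longrightarrow> S (T x) = T (S x)"
  by (metis blinfun_apply_blinfun_compose)

lemma op_poly_commute:
  assumes "A o\<^sub>L D = D o\<^sub>L A"
  shows "op_poly p A (D x) = D (op_poly p A x)"
  by (induction p) (simp_all add: blinfun.bilinear_simps blinfun_commute_apply[OF assms])

lemma op_poly_complex_linear:
  assumes "A \<in> bounded_ops"
  shows "op_poly p A \<in> bounded_ops"
proof -
  have A: "A (c *\<^sub>C x) = c *\<^sub>C A x" for c x
    using assms by (simp add: bounded_ops_def)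
  have "op_poly p A (c *\<^sub>C x) = c *\<^sub>C op_poly p A x" for c x
    \<comment> \<open>The final \<open>metis\<close> settles \<open>0 = c *\<^sub>C 0\<close> in the
      base case, which follows from additivity of the scaling.\<close>
    by (induction p)
      (simp_all add: blinfun.bilinear_simps A scaleR_scaleC scaleC_scaleC scaleC_add_right
        mult.commute, metis add_cancel_right_right scaleC_add_right)
  then show ?thesis by (simp add: bounded_ops_def)
qed

text \<open>The product rule puts a factor \<open>D\<close> between powers of
  \<open>A + s *\<^sub>R D\<close>. Since \<open>D\<close> commutes with this operator, all these
  factors move to the right and the scalar formula for the derivative survives.\<close>

lemma has_vector_derivative_op_poly:
  assumes "A o\<^sub>L D = D o\<^sub>L A"
  shows "((\<lambda>s. op_poly p (A + s *\<^sub>R D) x) has_vector_derivative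
    op_poly (pderiv p) (A + s *\<^sub>R D) (D x)) (at s)"
proof (induction p)
  case 0
  then show ?case by simp
next
  case (pCons a p)
  note [derivative_intros] = pCons.IH
    bounded_linear.has_vector_derivative[OF blinfun.bounded_linear_right]
  have comm: "(A + s *\<^sub>R D) o\<^sub>L D = D o\<^sub>L (A + s *\<^sub>R D)"
    by (intro blinfun_eqI) (simp add: blinfun.bilinear_simps blinfun_commute_apply[OF assms])
  have "((\<lambda>s. a *\<^sub>R x + A (op_poly p (A + s *\<^sub>R D) x) + s *\<^sub>R D (op_poly p (A + s *\<^sub>R D) x))
      has_vector_derivative
      (A (op_poly (pderiv p) (A + s *\<^sub>R D) (D x)) + (s *\<^sub>R D (op_poly (pderiv p) (A + s *\<^sub>R D) (D x))
        + D (op_poly p (A + s *\<^sub>R D) x)))) (at s)"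
    by (auto intro!: derivative_eq_intros)
  then show ?case
    by (simp add: pderiv_pCons op_poly_add blinfun.bilinear_simps op_poly_commute[OF comm] algebra_simps)
qed

section \<open>Self-adjoint operators\<close>

text \<open>The real inner product suffices: for a complex-linear operator, replacing
  \<open>y\<close> by \<open>\<i> *\<^sub>C y\<close> recovers the imaginary part of the identity
  for \<open>cinner\<close>. The estimates below can thus stay within real inner product
  spaces.\<close>

definition selfadjoint :: "('a::real_inner \<Rightarrow>\<^sub>L 'a) \<Rightarrow> bool"
  where "selfadjoint T \<longleftrightarrow> (\<forall>x y. inner (T x) y = inner x (T y))"

lemma selfadjointD: "selfadjoint T \<Longrightarrow> inner (T x) y = inner x (T y)"
  by (simp add: selfadjoint_def)

lemma cinner_add_right: "cinner x (y + z) = cinner x y + cinner x z"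
  by (metis cinner_add_left cinner_commute complex_cnj_add)

lemma cinner_scaleC_right: "cinner x (c *\<^sub>C y) = cnj c * cinner x y"
  by (metis cinner_commute cinner_scaleC_left complex_cnj_mult)

lemma cinner_conv_inner: "cinner x y = Complex (inner x y) (inner x (\<i> *\<^sub>C y))"
  by (simp add: complex_eq_iff inner_eq_Re_cinner cinner_scaleC_right)

lemma positive_op_inner_nonneg: "positive_op T \<Longrightarrow> inner (T x) x \<ge> 0"
  by (simp add: positive_op_def inner_eq_Re_cinner complex_nonneg_Reals_iff)

lemma positive_op_imp_selfadjoint:
  assumes "T \<in> bounded_ops" and "positive_op T"
  shows "selfadjoint T"
  unfolding selfadjoint_def
proof (intro allI)
  fix x y
  have T: "T (c *\<^sub>C x) = c *\<^sub>C T x" for c x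
    using assms(1) by (simp add: bounded_ops_def)
  have real: "Im (cinner (T x) x) = 0" for x
    using assms(2) by (simp add: positive_op_def complex_nonneg_Reals_iff)
  \<comment> \<open>Polarization: the cross terms are i<Tx, y> and -i<Ty, x>, whose imaginary parts
    are Re <Tx, y> and -Re <Ty, x>. The diagonal terms are real.\<close>
  have "Im (cinner (T (\<i> *\<^sub>C x + y)) (\<i> *\<^sub>C x + y)) = 0"
    by (rule real)
  then have "Re (cinner (T x) y) = Re (cinner (T y) x)"
    using real[of x] real[of y]
    by (simp add: blinfun.add_right T cinner_add_left cinner_add_right cinner_scaleC_left
        cinner_scaleC_right)
  then show "inner (T x) y = inner x (T y)"
    by (metis inner_commute inner_eq_Re_cinner)
qed

text \<open>The last hypothesis controls only the real part of the quadratic form. Its imaginary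
  part is \<open>inner (T x) (\<i> *\<^sub>C x)\<close>, which equals its own negative because
  multiplication by i is skew for the real inner product and commutes with \<open>T\<close>.\<close>

lemma selfadjoint_imp_positive_op:
  assumes "T \<in> bounded_ops" and "selfadjoint T" and "\<And>x. inner (T x) x \<ge> 0"
  shows "positive_op T"
  unfolding positive_op_def
proof
  fix x
  have "inner (T x) (\<i> *\<^sub>C x) = inner x (\<i> *\<^sub>C T x)"
    using assms(1,2) by (simp add: bounded_ops_def selfadjoint_def)
  also have "\<dots> = - inner (T x) (\<i> *\<^sub>C x)"
    by (simp add: inner_eq_Re_cinner cinner_scaleC_right) (subst cinner_commute, simp)
  finally have "inner (T x) (\<i> *\<^sub>C x) = 0"
    by simp
  then show "cinner (T x) x \<in> \<real>\<^sub>\<ge>\<^sub>0"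
    using assms(3) by (simp add: cinner_conv_inner complex_nonneg_Reals_iff)
qed

lemma positive_op_LIMSEQ:
  assumes "X \<longlonglongrightarrow> T" and "\<And>n. positive_op (X n)"
  shows "positive_op T"
  unfolding positive_op_def
proof
  fix x
  have "(\<lambda>n. cinner (X n x) x) \<longlonglongrightarrow> cinner (T x) x"
    unfolding cinner_conv_inner
    by (intro tendsto_Complex tendsto_intros tendsto_inner blinfun.tendsto assms(1))
  moreover have "cinner (X n x) x \<in> \<real>\<^sub>\<ge>\<^sub>0" for n
    using assms(2) by (simp add: positive_op_def)
  ultimately show "cinner (T x) x \<in> \<real>\<^sub>\<ge>\<^sub>0"
    by (meson closed_nonneg_Reals_complex closed_sequentially)
qed

lemma selfadjoint_op_poly:
  assumes "selfadjoint A"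
  shows "selfadjoint (op_poly p A)"
proof (induction p)
  case 0
  then show ?case by (simp add: selfadjoint_def)
next
  case (pCons a p)
  have "op_poly p A (A x) = A (op_poly p A x)" for x
    by (rule op_poly_commute) simp
  with pCons.IH assms show ?case
    by (simp add: selfadjoint_def blinfun.bilinear_simps inner_add_left inner_add_right)
qed

text \<open>With l the norm of T, expand |T^2 x - l^2 x|^2 and use |T^2 x| <= l |Tx|. A lower bound
  c would give |Tx|^2 <= (l^2 - c^2/l^2) |x|^2, hence an operator norm below l. The vector
  \<open>z\<close> excludes the trivial space and yields both l > 0 and the nonnegativity of the
  number under the root.\<close>

lemma not_bounded_below_norm:
  fixes T :: "'a::real_inner \<Rightarrow>\<^sub>L 'a"
  assumes "selfadjoint T" and "z \<noteq> (0::'a)"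
    and "0 < c" and bb: "\<And>x. c * norm x \<le> norm (T (T x) - (norm T)\<^sup>2 *\<^sub>R x)"
  shows False
proof -
  define l where "l = norm T"
  have *: "(norm (T x))\<^sup>2 * l\<^sup>2 \<le> l^4 * (norm x)\<^sup>2 - c\<^sup>2 * (norm x)\<^sup>2" for x
  proof -
    have "inner (T (T x)) x = (norm (T x))\<^sup>2"
      using assms(1) by (simp add: selfadjointD power2_norm_eq_inner)
    then have "(norm (T (T x) - l\<^sup>2 *\<^sub>R x))\<^sup>2
        = (norm (T (T x)))\<^sup>2 - 2 * l\<^sup>2 * (norm (T x))\<^sup>2 + l^4 * (norm x)\<^sup>2"
      unfolding power2_norm_eq_inner
      by (simp add: inner_diff_left inner_diff_right inner_commute power4_eq_xxxx power2_eq_square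
          algebra_simps)
    moreover have "(norm (T (T x)))\<^sup>2 \<le> l\<^sup>2 * (norm (T x))\<^sup>2"
      by (metis l_def norm_blinfun norm_ge_zero power_mono power_mult_distrib)
    moreover have "(c * norm x)\<^sup>2 \<le> (norm (T (T x) - l\<^sup>2 *\<^sub>R x))\<^sup>2"
      using bb assms(3) by (intro power_mono) (auto simp: l_def)
    ultimately show ?thesis
      by (simp add: power_mult_distrib algebra_simps)
  qed
  have "l > 0"
  proof (rule ccontr)
    assume "\<not> l > 0"
    then have "T = 0" by (simp add: l_def)
    with bb[of z] assms(2,3) show False by (simp add: mult_le_0_iff)
  qed
  define k where "k = sqrt (l\<^sup>2 - c\<^sup>2 / l\<^sup>2)"
  have **: "(norm (T x))\<^sup>2 \<le> (l\<^sup>2 - c\<^sup>2 / l\<^sup>2) * (norm x)\<^sup>2" for x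
    using *[of x] \<open>l > 0\<close> by (simp add: field_simps power4_eq_xxxx power2_eq_square)
  have nn: "l\<^sup>2 - c\<^sup>2 / l\<^sup>2 \<ge> 0"
    using order_trans[OF zero_le_power2 **[of z]] assms(2)
    by (simp add: zero_le_mult_iff)
  have "norm (T x) \<le> k * norm x" for x
    using real_sqrt_le_mono[OF **[of x]] nn by (simp add: real_sqrt_mult k_def)
  then have "l \<le> k"
    unfolding l_def by (intro norm_blinfun_bound) (use nn in \<open>auto simp: k_def\<close>)
  then have "l\<^sup>2 \<le> k\<^sup>2"
    using \<open>l > 0\<close> by (intro power_mono) auto
  with nn have "c\<^sup>2 / l\<^sup>2 \<le> 0" by (simp add: k_def)
  with \<open>l > 0\<close> \<open>c > 0\<close> show False
    by (simp add: divide_le_0_iff)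
qed

lemma op_poly_mono_of_pderiv_square:
  assumes "selfadjoint A" and "selfadjoint B" and "A o\<^sub>L B = B o\<^sub>L A"
    and "\<And>x. inner ((B - A) x) x \<ge> 0" and "pderiv p = r * r"
  shows "inner (op_poly p A x) x \<le> inner (op_poly p B x) x"
proof -
  define D where "D = B - A"
  have AD: "A o\<^sub>L D = D o\<^sub>L A"
    by (intro blinfun_eqI)
      (simp add: D_def blinfun.bilinear_simps blinfun_commute_apply[OF assms(3)])
  have "inner (op_poly p (A + 0 *\<^sub>R D) x) x \<le> inner (op_poly p (A + 1 *\<^sub>R D) x) x"
  proof (rule DERIV_nonneg_imp_nondecreasing[OF zero_le_one], intro exI conjI)
    fix s :: real
    let ?C = "A + s *\<^sub>R D"
    have comm: "?C o\<^sub>L D = D o\<^sub>L ?C"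
      by (intro blinfun_eqI) (simp add: blinfun.bilinear_simps blinfun_commute_apply[OF AD])
    have sa: "selfadjoint (op_poly r ?C)"
      by (rule selfadjoint_op_poly)
        (use assms(1,2) in \<open>simp add: selfadjoint_def D_def blinfun.bilinear_simps inner_add_left
          inner_add_right inner_diff_left inner_diff_right\<close>)
    show "((\<lambda>s. inner (op_poly p (A + s *\<^sub>R D) x) x) has_real_derivative
        inner (op_poly (pderiv p) ?C (D x)) x) (at s)"
      using bounded_linear.has_vector_derivative[OF bounded_linear_inner_left
          has_vector_derivative_op_poly[OF AD, of p x s]]
      by (simp add: has_real_derivative_iff_has_vector_derivative)
    \<comment> \<open>One factor of r(C)^2 commutes past \<open>D\<close>, the other crosses the
      inner product by self-adjointness.\<close>
    have "inner (op_poly (pderiv p) ?C (D x)) x = inner (D (op_poly r ?C x)) (op_poly r ?C x)"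
      by (simp add: assms(5) op_poly_mult op_poly_commute[OF comm] flip: selfadjointD[OF sa])
    then show "0 \<le> inner (op_poly (pderiv p) ?C (D x)) x"
      using assms(4) by (simp add: D_def)
  qed
  then show ?thesis by (simp add: D_def)
qed

section \<open>The spectrum and the norm of a polynomial\<close>

lemma poly_map_poly_of_real_add:
  "poly (map_poly of_real (p + q)) (z::'a::real_field)
    = poly (map_poly of_real p) z + poly (map_poly of_real q) z"
  by (induction p q rule: poly_induct2) (simp_all add: map_poly_pCons algebra_simps)

lemma poly_map_poly_of_real_mult:
  "poly (map_poly of_real (p * q)) (z::'a::real_field)
    = poly (map_poly of_real p) z * poly (map_poly of_real q) z"
proof (induction p)
  case 0
  then show ?case by simp
next
  case (pCons a p)
  have "poly (map_poly of_real (smult a q)) z = of_real a * poly (map_poly of_real q) z"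
    by (induction q) (simp_all add: map_poly_pCons algebra_simps)
  with pCons.IH show ?case
    by (simp add: map_poly_pCons poly_map_poly_of_real_add algebra_simps)
qed

text \<open>Take a complex root z, which cannot be real, and divide by the real quadratic with roots
  z and its conjugate. The form (t - a)^2 + b^2 with b nonzero makes this factor visibly bounded
  below at a self-adjoint operator.\<close>

lemma real_poly_quadratic_factor:
  fixes q :: "real poly"
  assumes "degree q > 0" and "\<And>t. poly q t \<noteq> 0"
  obtains a b r where "b \<noteq> 0" and "q = [:a\<^sup>2 + b\<^sup>2, - 2 * a, 1:] * r"
proof -
  have "degree (map_poly complex_of_real q) = degree q"
    by (rule degree_map_poly) simp
  with assms(1) have "\<not> constant (poly (map_poly complex_of_real q))"
    by (simp add: constant_degree)
  then obtain z where z: "poly (map_poly complex_of_real q) z = 0"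
    using fundamental_theorem_of_algebra by blast
  define D where "D = [:(Re z)\<^sup>2 + (Im z)\<^sup>2, - 2 * Re z, 1:]"
  have of_real: "poly (map_poly of_real p) (complex_of_real t) = of_real (poly p t)" for p t
    by (induction p) (simp_all add: map_poly_pCons)
  have Im: "Im z \<noteq> 0"
  proof
    assume "Im z = 0"
    then have "z = complex_of_real (Re z)" by (simp add: complex_eq_iff)
    with z of_real[of q "Re z"] assms(2) show False by simp
  qed
  have D: "poly (map_poly of_real D) z = 0"
    by (simp add: D_def map_poly_pCons complex_eq_iff power2_eq_square algebra_simps)
  have "poly (map_poly of_real (D * (q div D) + q mod D)) z = 0"
    using z by simp
  then have m: "poly (map_poly of_real (q mod D)) z = 0"
    unfolding poly_map_poly_of_real_add poly_map_poly_of_real_mult D by simp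
  have "degree (q mod D) < 2"
    using degree_mod_less[of D q] by (auto simp: D_def)
  then have "q mod D = [:coeff (q mod D) 0, coeff (q mod D) 1:]"
    by (intro poly_eqI) (auto simp: coeff_pCons coeff_eq_0 split: nat.split)
  then obtain c d where cd: "q mod D = [:c, d:]" by blast
  \<comment> \<open>From c + d z = 0 with c and d real, the imaginary part gives d = 0, and then c =
    0.\<close>
  with m Im have "q mod D = 0"
    by (auto simp: map_poly_pCons complex_eq_iff)
  then have "q = D * (q div D)"
    by (metis add.right_neutral mult_div_mod_eq)
  with Im that show thesis unfolding D_def by blast
qed

text \<open>Split off real factors one at a time, since a composition of operators bounded below is
  bounded below. A linear factor has its root outside the spectrum and so is invertible at
  \<open>A\<close>. A quadratic one satisfies <((A - a)^2 + b^2)x, x> >= b^2 |x|^2, and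
  Cauchy-Schwarz gives the bound \<open>b\<^sup>2\<close>.\<close>

lemma op_poly_bounded_below:
  assumes "selfadjoint A" and "q \<noteq> 0"
    and "\<And>t. complex_of_real t \<in> op_spectrum A \<Longrightarrow> poly q t \<noteq> 0"
  shows "\<exists>c>0. \<forall>x. c * norm x \<le> norm (op_poly q A x)"
  using assms(2,3)
proof (induction "degree q" arbitrary: q rule: less_induct)
  case less
  have step: ?case if "q = d * r" and "degree d > 0" and "k > 0"
    and k: "\<And>x. k * norm x \<le> norm (op_poly d A x)" for d r k
  proof -
    have "d \<noteq> 0" "r \<noteq> 0" using that(1) less.prems(1) by auto
    then have "degree r < degree q"
      using that(1,2) by (simp add: degree_mult_eq)
    moreover have "\<And>t. complex_of_real t \<in> op_spectrum A \<Longrightarrow> poly r t \<noteq> 0"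
      using less.prems(2) that(1) by fastforce
    ultimately obtain c where c: "c > 0" "\<And>x. c * norm x \<le> norm (op_poly r A x)"
      using less.hyps \<open>r \<noteq> 0\<close> by blast
    have "(k * c) * norm x \<le> norm (op_poly q A x)" for x
    proof -
      have "k * (c * norm x) \<le> k * norm (op_poly r A x)"
        using c that(3) by (intro mult_left_mono) auto
      also have "\<dots> \<le> norm (op_poly q A x)"
        using k by (simp add: that(1) op_poly_mult)
      finally show ?thesis by (simp add: mult.assoc)
    qed
    then show ?thesis using c(1) that(3) by (intro exI[of _ "k * c"]) simp
  qed
  consider "degree q = 0" | t where "poly q t = 0" | "degree q > 0" "\<And>t. poly q t \<noteq> 0"
    by blast
  then show ?case
  proof cases
    case 1
    then obtain a where "q = [:a:]" using degree_eq_zeroE by blast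
    with less.prems(1) show ?thesis
      by (intro exI[of _ "\<bar>a\<bar>"]) (auto simp: blinfun.bilinear_simps)
  next
    case (2 t)
    then obtain r where r: "q = [:- t, 1:] * r"
      by (metis dvdE poly_eq_0_iff_dvd)
    have "complex_of_real t \<notin> op_spectrum A"
      using less.prems(2) 2 by blast
    then obtain S :: "'a \<Rightarrow>\<^sub>L 'a" where S: "\<And>x. S (A x - t *\<^sub>R x) = x"
      by (auto simp: op_spectrum_def scaleR_scaleC)
    \<comment> \<open>The summand 1 keeps the constant invertible even if \<open>S\<close> is 0, as
      on the trivial space.\<close>
    have "norm x \<le> (norm S + 1) * norm (A x - t *\<^sub>R x)" for x
      using norm_blinfun[of S "A x - t *\<^sub>R x"] by (simp add: S algebra_simps add_increasing)
    moreover have "norm S + 1 > 0"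
      by (simp add: add_nonneg_pos)
    ultimately have "inverse (norm S + 1) * norm x \<le> norm (op_poly [:- t, 1:] A x)" for x
      by (simp add: blinfun.bilinear_simps field_simps)
    with r \<open>norm S + 1 > 0\<close> show ?thesis
      by (intro step[of "[:- t, 1:]" r "inverse (norm S + 1)"]) auto
  next
    case 3
    then obtain a b r where b: "b \<noteq> 0" and r: "q = [:a\<^sup>2 + b\<^sup>2, - 2 * a, 1:] * r"
      using real_poly_quadratic_factor by metis
    have "b\<^sup>2 * norm x \<le> norm (op_poly [:a\<^sup>2 + b\<^sup>2, - 2 * a, 1:] A x)" for x
    proof (cases "x = 0")
      case False
      let ?y = "op_poly [:a\<^sup>2 + b\<^sup>2, - 2 * a, 1:] A x"
      have "inner ?y x = (norm (A x - a *\<^sub>R x))\<^sup>2 + b\<^sup>2 * (norm x)\<^sup>2"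
        unfolding power2_norm_eq_inner using assms(1)
        by (simp add: blinfun.bilinear_simps inner_add_left inner_add_right inner_diff_left
            inner_diff_right selfadjointD inner_commute power2_eq_square algebra_simps)
      then have "b\<^sup>2 * (norm x)\<^sup>2 \<le> inner ?y x" by simp
      also have "\<dots> \<le> norm ?y * norm x" by (rule norm_cauchy_schwarz)
      finally show ?thesis
        using False by (simp add: power2_eq_square)
    qed simp
    with r b show ?thesis
      by (intro step[of "[:a\<^sup>2 + b\<^sup>2, - 2 * a, 1:]" r "b\<^sup>2"]) auto
  qed
qed

lemma norm_op_poly_le:
  assumes "selfadjoint A" and "0 \<le> e"
    and "\<And>t. complex_of_real t \<in> op_spectrum A \<Longrightarrow> \<bar>poly p t\<bar> \<le> e"
  shows "norm (op_poly p A) \<le> e"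
proof (rule ccontr)
  assume gt: "\<not> norm (op_poly p A) \<le> e"
  \<comment> \<open>As \<open>e\<close> is nonnegative, a violation of the bound forces a nonzero
    operator and so a nonzero vector. On the trivial space the spectrum would be empty and no root
    could be found.\<close>
  with assms(2) have "op_poly p A \<noteq> 0" by auto
  then obtain z where z: "z \<noteq> (0::'a)"
    by (metis blinfun.zero_left blinfun.zero_right blinfun_eqI)
  have sq: "op_poly (r * r - [:(norm (op_poly r A))\<^sup>2:]) A x
      = op_poly r A (op_poly r A x) - (norm (op_poly r A))\<^sup>2 *\<^sub>R x" for r x
    by (simp add: op_poly_diff op_poly_mult blinfun.bilinear_simps)
  have root: "\<exists>t. complex_of_real t \<in> op_spectrum A \<and> poly r t * poly r t = (norm (op_poly r A))\<^sup>2"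
    if "r * r \<noteq> [:(norm (op_poly r A))\<^sup>2:]" for r
  proof (rule ccontr)
    assume "\<not> ?thesis"
    then have "poly (r * r - [:(norm (op_poly r A))\<^sup>2:]) t \<noteq> 0"
      if "complex_of_real t \<in> op_spectrum A" for t
      using that by simp
    moreover have "r * r - [:(norm (op_poly r A))\<^sup>2:] \<noteq> 0"
      using that by (simp del: diff_pCons)
    ultimately obtain c where "c > 0"
      and "\<And>x. c * norm x \<le> norm (op_poly (r * r - [:(norm (op_poly r A))\<^sup>2:]) A x)"
      using op_poly_bounded_below[OF assms(1)] by blast
    then show False
      using not_bounded_below_norm[OF selfadjoint_op_poly[OF assms(1)] z] unfolding sq by blast
  qed
  \<comment> \<open>If the polynomial whose root is sought vanishes identically, every point of the real
    spectrum is a root; that spectrum is nonempty by the same argument for the identity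
    polynomial.\<close>
  obtain t where t: "complex_of_real t \<in> op_spectrum A"
    "poly p t * poly p t = (norm (op_poly p A))\<^sup>2"
  proof (cases "p * p = [:(norm (op_poly p A))\<^sup>2:]")
    case True
    obtain t where "complex_of_real t \<in> op_spectrum A"
      using root[of "[:0, 1:]"] by auto
    moreover have "poly p t * poly p t = (norm (op_poly p A))\<^sup>2"
      using arg_cong[OF True, of "\<lambda>q. poly q t"] by simp
    ultimately show thesis by (rule that)
  next
    case False
    then show thesis using root that by blast
  qed
  then have "\<bar>poly p t\<bar>\<^sup>2 = (norm (op_poly p A))\<^sup>2"
    by (simp add: power2_eq_square)
  then have "\<bar>poly p t\<bar> = norm (op_poly p A)"
    by (simp only: power2_eq_iff_nonneg abs_ge_zero norm_ge_zero)
  with assms(3)[OF t(1)] gt show False by simp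
qed

section \<open>Coercive operators and the location of the real spectrum\<close>

text \<open>The Lax-Milgram argument: solutions of T x = y are the fixed points of x - s (T x - y),
  which is a contraction for a suitable step size s.\<close>

lemma coercive_bij:
  fixes T :: "'a::{real_inner, complete_space} \<Rightarrow>\<^sub>L 'a"
  assumes "0 < c" and coer: "\<And>x. c * (norm x)\<^sup>2 \<le> inner (T x) x"
  shows "bij (blinfun_apply T)"
proof -
  \<comment> \<open>This \<open>M\<close> is positive and dominates both \<open>norm T\<close> and
    \<open>c\<close>, so the number under the root in \<open>k\<close> is nonnegative. The value of
    \<open>s\<close> minimizes 1 - 2 s c + s^2 M^2.\<close>
  define M where "M = norm T + c"
  define s where "s = c / M\<^sup>2"
  have M: "c \<le> M" "norm T \<le> M" "0 < M" using assms(1) by (auto simp: M_def add_nonneg_pos)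
  define k where "k = sqrt (1 - (c / M)\<^sup>2)"
  have k01: "0 \<le> 1 - (c / M)\<^sup>2" "1 - (c / M)\<^sup>2 < 1"
    using M assms(1) by (auto simp: power_le_one)
  have contr: "norm (x - s *\<^sub>R T x) \<le> k * norm x" for x
  proof -
    have "(norm (x - s *\<^sub>R T x))\<^sup>2 = (norm x)\<^sup>2 - 2 * s * inner (T x) x + s\<^sup>2 * (norm (T x))\<^sup>2"
      unfolding power2_norm_eq_inner
      by (simp add: inner_diff_left inner_diff_right inner_commute power2_eq_square algebra_simps)
    also have "\<dots> \<le> (norm x)\<^sup>2 - 2 * s * (c * (norm x)\<^sup>2) + s\<^sup>2 * (M * norm x)\<^sup>2"
    proof -
      have "norm (T x) \<le> M * norm x"
        using norm_blinfun[of T x] M(2) by (meson mult_right_mono norm_ge_zero order_trans)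
      then show ?thesis
        using coer[of x] assms(1)
        by (intro add_mono diff_mono mult_left_mono power_mono) (auto simp: s_def)
    qed
    also have "\<dots> = (1 - (c / M)\<^sup>2) * (norm x)\<^sup>2"
      using M(3) by (simp add: s_def field_simps power2_eq_square)
    finally show ?thesis
      using real_sqrt_le_mono k01(1) by (fastforce simp: k_def real_sqrt_mult)
  qed
  have "s > 0" using assms(1) M(3) by (simp add: s_def)
  have "\<exists>!x. T x = y" for y
  proof -
    have "\<exists>!x. x - s *\<^sub>R (T x - y) = x"
    proof (rule banach_fix_type[of k])
      show "0 \<le> k" "k < 1" using k01 by (auto simp: k_def)
      have "x - s *\<^sub>R (T x - y) - (x' - s *\<^sub>R (T x' - y)) = (x - x') - s *\<^sub>R T (x - x')" for x x'
        by (simp add: blinfun.bilinear_simps algebra_simps)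
      then show "\<forall>x x'. dist (x - s *\<^sub>R (T x - y)) (x' - s *\<^sub>R (T x' - y)) \<le> k * dist x x'"
        using contr by (simp only: dist_norm) blast
    qed
    then show ?thesis using \<open>s > 0\<close> by simp
  qed
  then show ?thesis by (metis bijI')
qed

text \<open>The sign \<open>e\<close> treats points below and above the numerical range together.
  Bijectivity alone is not enough: the inverse must be shown complex-linear and, by coercivity,
  bounded.\<close>

lemma coercive_not_in_spectrum:
  assumes "A \<in> bounded_ops" and "0 < c" and "\<bar>e\<bar> = 1"
    and coer: "\<And>x. c * (norm x)\<^sup>2 \<le> e * inner (A x - t *\<^sub>R x) x"
  shows "complex_of_real t \<notin> op_spectrum A"
proof -
  define T where "T = e *\<^sub>R (A - t *\<^sub>R id_blinfun)"
  have T: "T x = e *\<^sub>R (A x - t *\<^sub>R x)" for x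
    by (simp add: T_def blinfun.bilinear_simps)
  have e: "e * e = 1" using assms(3) by (auto simp: abs_if split: if_splits)
  have coerT: "c * (norm x)\<^sup>2 \<le> inner (T x) x" for x
    using coer by (simp add: T)
  have bij: "bij (blinfun_apply T)"
    by (rule coercive_bij[OF assms(2) coerT])
  define S where "S = inv (blinfun_apply T)"
  have TS: "T (S x) = x" for x
    using bij by (simp add: S_def bij_is_surj surj_f_inv_f)
  have ST: "S (T x) = x" for x
    using bij by (simp add: S_def bij_is_inj)
  \<comment> \<open>\<open>T\<close> is the linear polynomial \<open>[:- t * e, e:]\<close> in
    \<open>A\<close>, so it inherits complex linearity.\<close>
  have T_C: "T (d *\<^sub>C x) = d *\<^sub>C T x" for d x
    using op_poly_complex_linear[OF assms(1), of "[:- t * e, e:]"]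
    by (simp add: bounded_ops_def T blinfun.bilinear_simps scaleR_diff_right mult.commute)
  have S_add: "S (x + y) = S x + S y" for x y
    by (metis ST TS blinfun.add_right)
  have S_C: "S (d *\<^sub>C x) = d *\<^sub>C S x" for d x
    by (metis ST TS T_C)
  have S_R: "S (d *\<^sub>R x) = d *\<^sub>R S x" for d x
    by (simp add: scaleR_scaleC S_C)
  have S_bd: "norm (S x) \<le> norm x * (1 / c)" for x
  proof (cases "S x = 0")
    case True
    then show ?thesis using assms(2) by simp
  next
    case False
    have "c * (norm (S x))\<^sup>2 \<le> inner x (S x)"
      using coerT[of "S x"] by (simp add: TS)
    also have "\<dots> \<le> norm x * norm (S x)" by (rule norm_cauchy_schwarz)
    finally show ?thesis
      using False assms(2) by (simp add: power2_eq_square field_simps)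
  qed
  have "bounded_linear S"
    by (rule bounded_linear_intro[of S "1 / c"]) (simp_all only: S_add S_R S_bd)
  \<comment> \<open>Since e * e = 1, the inverse of \<open>A - t\<close> is e times the inverse of
    \<open>T\<close>.\<close>
  then have bl: "blinfun_apply (Blinfun (\<lambda>x. e *\<^sub>R S x)) = (\<lambda>x. e *\<^sub>R S x)"
    by (intro bounded_linear_Blinfun_apply bounded_linear_const_scaleR)
  have "Blinfun (\<lambda>x. e *\<^sub>R S x) \<in> bounded_ops"
    by (simp only: bounded_ops_def mem_Collect_eq bl)
      (simp add: S_C scaleR_scaleC scaleC_scaleC mult.commute)
  moreover have "e *\<^sub>R S (A x - t *\<^sub>R x) = x" for x
    using ST[of x] by (simp add: T S_R)
  moreover have "A (e *\<^sub>R S x) - t *\<^sub>R e *\<^sub>R S x = x" for x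
    using TS[of x] by (simp add: T blinfun.bilinear_simps scaleR_diff_right mult.commute)
  ultimately have "\<exists>R\<in>bounded_ops. \<forall>x. blinfun_apply R (A x - t *\<^sub>R x) = x
      \<and> A (blinfun_apply R x) - t *\<^sub>R blinfun_apply R x = x"
    by (intro bexI) (simp_all add: bl)
  then show ?thesis
    by (simp add: op_spectrum_def scaleR_scaleC)
qed

text \<open>For t < 0 the operator A - t is coercive with constant -t; for t > |A| the operator t -
  A is coercive with constant t - |A|. Uniform approximation on a compact interval therefore
  suffices for the functional calculus.\<close>

lemma positive_op_real_spectrum:
  assumes "A \<in> bounded_ops" and "positive_op A"
  shows "{t. complex_of_real t \<in> op_spectrum A} \<subseteq> {0..norm A}"
proof
  fix t
  assume "t \<in> {t. complex_of_real t \<in> op_spectrum A}"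
  then have t: "complex_of_real t \<in> op_spectrum A" by simp
  have "\<not> t < 0"
  proof
    assume "t < 0"
    then have "complex_of_real t \<notin> op_spectrum A"
      using positive_op_inner_nonneg[OF assms(2)]
      by (intro coercive_not_in_spectrum[OF assms(1), of "- t" 1])
        (simp_all add: inner_diff_left power2_norm_eq_inner)
    with t show False by simp
  qed
  moreover have "\<not> t > norm A"
  proof
    assume "t > norm A"
    have "inner (A x) x \<le> norm A * (norm x)\<^sup>2" for x
      using norm_cauchy_schwarz[of "A x" x] mult_right_mono[OF norm_blinfun[of A x], of "norm x"]
      by (simp add: power2_eq_square mult.assoc)
    with \<open>t > norm A\<close> have "complex_of_real t \<notin> op_spectrum A"
      by (intro coercive_not_in_spectrum[OF assms(1), of "t - norm A" "- 1"])
        (simp_all add: inner_diff_left algebra_simps flip: power2_norm_eq_inner)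
    with t show False by simp
  qed
  ultimately show "t \<in> {0..norm A}" by simp
qed

section \<open>Functional calculus and powers\<close>

text \<open>This discharges the definite description in \<open>cont_fun_calc\<close>. The norm bound
  over the spectrum makes the polynomial values Cauchy, which gives existence, and makes any two
  approximating sequences have the same limit, which gives uniqueness.\<close>

lemma cont_fun_calc_LIMSEQ:
  fixes A :: "'a::complex_hilbert \<Rightarrow>\<^sub>L 'a"
  assumes "selfadjoint A"
    and p: "uniform_limit {t. complex_of_real t \<in> op_spectrum A} (\<lambda>n. poly (p n)) f sequentially"
  shows "(\<lambda>n. op_poly (p n) A) \<longlonglongrightarrow> cont_fun_calc f A"
proof -
  let ?\<sigma> = "{t. complex_of_real t \<in> op_spectrum A}"
  \<comment> \<open>Triangle inequality through \<open>f t\<close> at each spectral point. The bound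
    is not strict, so the uses below take e/3 twice to stay under e.\<close>
  have close: "norm (op_poly q A - op_poly q' A) \<le> e + e'"
    if "\<forall>t\<in>?\<sigma>. dist (poly q t) (f t) < e" "\<forall>t\<in>?\<sigma>. dist (poly q' t) (f t) < e'" "0 < e" "0 < e'"
    for q q' e e'
    unfolding op_poly_diff[symmetric]
    by (rule norm_op_poly_le[OF assms(1)]) (use that in \<open>fastforce simp: dist_real_def\<close>)+
  have "Cauchy (\<lambda>n. op_poly (p n) A)"
  proof (rule CauchyI)
    fix e :: real
    assume "e > 0"
    then obtain N where "\<And>n. n \<ge> N \<Longrightarrow> \<forall>t\<in>?\<sigma>. dist (poly (p n) t) (f t) < e / 3"
      using p unfolding uniform_limit_sequentially_iff by (metis zero_less_divide_iff zero_less_numeral)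
    then have "norm (op_poly (p m) A - op_poly (p n) A) \<le> e / 3 + e / 3" if "m \<ge> N" "n \<ge> N" for m n
      using that \<open>e > 0\<close> by (intro close) auto
    moreover have "e / 3 + e / 3 < e" using \<open>e > 0\<close> by simp
    ultimately show "\<exists>N. \<forall>m\<ge>N. \<forall>n\<ge>N. norm (op_poly (p m) A - op_poly (p n) A) < e"
      by (meson order_le_less_trans)
  qed
  then obtain T where T: "(\<lambda>n. op_poly (p n) A) \<longlonglongrightarrow> T"
    using Cauchy_convergent convergentD by blast
  have "cont_fun_calc f A = T"
    unfolding cont_fun_calc_def
  proof (rule the_equality)
    show "\<exists>p. uniform_limit ?\<sigma> (\<lambda>n. poly (p n)) f sequentially \<and> (\<lambda>n. op_poly (p n) A) \<longlonglongrightarrow> T"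
      using p T by blast
  next
    fix T'
    assume "\<exists>p. uniform_limit ?\<sigma> (\<lambda>n. poly (p n)) f sequentially \<and> (\<lambda>n. op_poly (p n) A) \<longlonglongrightarrow> T'"
    then obtain q where q: "uniform_limit ?\<sigma> (\<lambda>n. poly (q n)) f sequentially"
      and T': "(\<lambda>n. op_poly (q n) A) \<longlonglongrightarrow> T'" by blast
    have "(\<lambda>n. op_poly (q n) A - op_poly (p n) A) \<longlonglongrightarrow> 0"
    proof (rule tendstoI)
      fix e :: real
      assume "e > 0"
      have "\<forall>\<^sub>F n in sequentially. \<forall>t\<in>?\<sigma>. dist (poly (q n) t) (f t) < e / 3"
        "\<forall>\<^sub>F n in sequentially. \<forall>t\<in>?\<sigma>. dist (poly (p n) t) (f t) < e / 3"
        using p q \<open>e > 0\<close> by (auto dest: uniform_limitD[of _ _ _ _ "e / 3"])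
      then show "\<forall>\<^sub>F n in sequentially. dist (op_poly (q n) A - op_poly (p n) A) 0 < e"
        by eventually_elim (use close[of _ "e / 3" _ "e / 3"] \<open>e > 0\<close> in fastforce)
    qed
    moreover have "(\<lambda>n. op_poly (q n) A - op_poly (p n) A) \<longlonglongrightarrow> T' - T"
      by (intro tendsto_diff T T')
    ultimately have "T' - T = 0" using LIMSEQ_unique by blast
    then show "T' = T" by simp
  qed
  with T show ?thesis by simp
qed

section \<open>Approximation by polynomials whose derivative is a square\<close>

lemma real_polynomial_approximation:
  fixes f :: "real \<Rightarrow> real"
  assumes "continuous_on {a..b} f" and "0 < e"
  obtains r where "\<And>x. x \<in> {a..b} \<Longrightarrow> \<bar>f x - poly r x\<bar> < e"
proof -
  obtain g where g: "real_polynomial_function g" "\<And>x. x \<in> {a..b} \<Longrightarrow> \<bar>f x - g x\<bar> < e"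
    using Stone_Weierstrass_real_polynomial_function[OF compact_Icc assms] by blast
  then obtain c n where "g = (\<lambda>x. \<Sum>i\<le>n. c i * x ^ i)"
    by (auto simp: real_polynomial_function_iff_sum)
  then have "g x = poly (\<Sum>i\<le>n. monom (c i) i) x" for x
    by (simp add: poly_sum poly_monom)
  with g(2) show thesis by (intro that) simp
qed

lemma poly_antiderivative:
  fixes q :: "'a::field_char_0 poly"
  obtains p where "pderiv p = q"
proof -
  have "\<exists>p. pderiv p = (\<Sum>i\<in>I. monom (coeff q i) i)" if "finite I" for I
    using that
  proof induction
    case (insert i I)
    then obtain p where p: "pderiv p = (\<Sum>i\<in>I. monom (coeff q i) i)" by blast
    have "pderiv (monom (coeff q i / of_nat (Suc i)) (Suc i) + p)
        = (\<Sum>i\<in>insert i I. monom (coeff q i) i)"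
      using insert.hyps by (simp add: p pderiv_add pderiv_monom del: of_nat_Suc)
    then show ?case by blast
  qed (auto intro: exI[of _ 0])
  from this[of "{..degree q}"] that show thesis
    by (auto simp: poly_as_sum_of_monoms)
qed

text \<open>Approximate the square root of the derivative \<open>g\<close> by a polynomial
  \<open>r\<close> and integrate \<open>r * r\<close>, matching the value of \<open>f\<close> at the
  left endpoint. The mean value inequality carries the error of the derivatives over to the
  functions.\<close>

lemma approximation_pderiv_square:
  fixes f g :: "real \<Rightarrow> real"
  assumes f: "\<And>x. x \<in> {a..b} \<Longrightarrow> (f has_real_derivative g x) (at x within {a..b})"
    and cont: "continuous_on {a..b} g" and nonneg: "\<And>x. x \<in> {a..b} \<Longrightarrow> 0 \<le> g x" and "0 < e"
  obtains p r where "pderiv p = r * r" and "\<And>x. x \<in> {a..b} \<Longrightarrow> \<bar>poly p x - f x\<bar> \<le> e"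
proof (cases "a \<le> b")
  case False
  then show thesis using that[of 0 0] by simp
next
  case True
  have cont_sqrt: "continuous_on {a..b} (\<lambda>x. sqrt (g x))"
    using cont by (intro continuous_intros)
  then have "bounded ((\<lambda>x. sqrt (g x)) ` {a..b})"
    by (intro compact_imp_bounded compact_continuous_image compact_Icc)
  then obtain K where K: "\<And>x. x \<in> {a..b} \<Longrightarrow> \<bar>sqrt (g x)\<bar> \<le> K"
    unfolding bounded_iff by (metis imageI real_norm_def)
  have "K \<ge> 0" using K[of a] True by (meson abs_ge_zero atLeastAtMost_iff order_refl order_trans)
  \<comment> \<open>With d <= 1 the sum of \<open>r\<close> and the root of \<open>g\<close> is at
    most 2K + 1 in absolute value, so the derivatives differ by at most d (2K + 1). The other entry
    brings this times b - a below e; its summand 1 next to b - a allows a = b.\<close>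
  define d where "d = min 1 (e / ((2 * K + 1) * (b - a + 1)))"
  have "d > 0" "d \<le> 1" using \<open>K \<ge> 0\<close> \<open>0 < e\<close> True by (auto simp: d_def)
  have de: "d * (2 * K + 1) * (b - a) \<le> e"
  proof -
    have "d * ((2 * K + 1) * (b - a)) \<le> d * ((2 * K + 1) * (b - a + 1))"
      using \<open>d > 0\<close> \<open>K \<ge> 0\<close> by (intro mult_left_mono) auto
    also have "\<dots> \<le> e / ((2 * K + 1) * (b - a + 1)) * ((2 * K + 1) * (b - a + 1))"
      using \<open>K \<ge> 0\<close> True by (intro mult_right_mono) (auto simp: d_def)
    also have "\<dots> = e"
      using \<open>K \<ge> 0\<close> True by (simp add: add_nonneg_eq_0_iff)
    finally show ?thesis by (simp add: mult.assoc)
  qed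
  obtain r where r: "\<And>x. x \<in> {a..b} \<Longrightarrow> \<bar>sqrt (g x) - poly r x\<bar> < d"
    using real_polynomial_approximation[OF cont_sqrt \<open>d > 0\<close>] by blast
  obtain p0 where p0: "pderiv p0 = r * r" using poly_antiderivative by blast
  define p where "p = p0 + [:f a - poly p0 a:]"
  have p: "pderiv p = r * r" by (simp add: p_def pderiv_add p0)
  have bound: "\<bar>poly (r * r) x - g x\<bar> \<le> d * (2 * K + 1)" if "x \<in> {a..b}" for x
  proof -
    have "\<bar>poly (r * r) x - g x\<bar> = \<bar>(poly r x - sqrt (g x)) * (poly r x + sqrt (g x))\<bar>"
      using nonneg[OF that] by (simp add: algebra_simps)
    also have "\<dots> = \<bar>poly r x - sqrt (g x)\<bar> * \<bar>poly r x + sqrt (g x)\<bar>"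
      by (rule abs_mult)
    also have "\<dots> \<le> d * (2 * K + 1)"
      using r[OF that] K[OF that] \<open>d > 0\<close> \<open>d \<le> 1\<close> by (intro mult_mono) auto
    finally show ?thesis .
  qed
  have "\<bar>poly p x - f x\<bar> \<le> e" if x: "x \<in> {a..b}" for x
  proof -
    have "norm ((poly p x - f x) - (poly p a - f a)) \<le> d * (2 * K + 1) * norm (x - a)"
    proof (rule field_differentiable_bound[of "{a..b}"])
      show "((\<lambda>x. poly p x - f x) has_field_derivative poly (r * r) y - g y) (at y within {a..b})"
        if "y \<in> {a..b}" for y
        by (intro DERIV_diff f that) (metis p poly_DERIV has_field_derivative_at_within)
      show "norm (poly (r * r) y - g y) \<le> d * (2 * K + 1)" if "y \<in> {a..b}" for y
        using bound[OF that] by simp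
    qed (use x True in auto)
    also have "\<dots> \<le> d * (2 * K + 1) * (b - a)"
      using x \<open>d > 0\<close> \<open>K \<ge> 0\<close> by (intro mult_left_mono) auto
    finally show ?thesis using de by (simp add: p_def)
  qed
  with p that show thesis by blast
qed

text \<open>Half of the error is spent on replacing t by t + h, the other half on approximating the
  shifted power, whose derivative is continuous and nonnegative on the interval.\<close>

lemma powr_approximation_pderiv_square:
  fixes \<alpha> M e :: real
  assumes "0 < \<alpha>" and "0 < e"
  obtains p r where "pderiv p = r * r"
    and "\<And>t. t \<in> {0..M} \<Longrightarrow> \<bar>poly p t - t powr \<alpha>\<bar> < e"
proof -
  \<comment> \<open>The interval reaches to M + 1 so that it contains the shifted points t + h with
    h <= 1. Continuity at 0 comes from the positive exponent.\<close>
  have "uniformly_continuous_on {0..M + 1} (\<lambda>t. t powr \<alpha>)"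
    using assms(1) by (intro compact_uniformly_continuous continuous_on_powr' continuous_intros) auto
  then obtain d where d: "d > 0" "\<And>s t. s \<in> {0..M + 1} \<Longrightarrow> t \<in> {0..M + 1} \<Longrightarrow> dist t s < d
      \<Longrightarrow> dist (t powr \<alpha>) (s powr \<alpha>) < e / 2"
    using assms(2) unfolding uniformly_continuous_on_def by (metis half_gt_zero)
  \<comment> \<open>The shift keeps the derivative continuous at 0 when the exponent is less than 1.\<close>
  define h where "h = min (d / 2) 1"
  have h: "0 < h" "h < d" "h \<le> 1" using d(1) by (auto simp: h_def)
  obtain p r where "pderiv p = r * r"
    and p: "\<And>t. t \<in> {0..M} \<Longrightarrow> \<bar>poly p t - (t + h) powr \<alpha>\<bar> \<le> e / 2"
  proof (rule approximation_pderiv_square[of 0 M "\<lambda>t. (t + h) powr \<alpha>"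
        "\<lambda>t. \<alpha> * (t + h) powr (\<alpha> - 1)" "e / 2"])
    show "((\<lambda>t. (t + h) powr \<alpha>) has_real_derivative \<alpha> * (t + h) powr (\<alpha> - 1)) (at t within {0..M})"
      if "t \<in> {0..M}" for t
      using that h(1) by (auto intro!: derivative_eq_intros)
    show "continuous_on {0..M} (\<lambda>t. \<alpha> * (t + h) powr (\<alpha> - 1))"
      using h(1) by (intro continuous_intros) auto
  qed (use assms in auto)
  moreover have "\<bar>poly p t - t powr \<alpha>\<bar> < e" if "t \<in> {0..M}" for t
    using p[OF that] d(2)[of t "t + h"] that h
    by (simp add: dist_real_def abs_if split: if_splits)
  ultimately show thesis using that by blast
qed

section \<open>Monotonicity of real powers on commuting positive operators\<close>

theorem proposition2p7:
  fixes A B :: "'a::complex_hilbert \<Rightarrow>\<^sub>L 'a" and \<alpha> :: real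
  assumes "A \<in> bounded_ops" and "B \<in> bounded_ops"
    and "positive_op A" and "positive_op B"
    and "A o\<^sub>L B = B o\<^sub>L A"
    and "A \<le>\<^sub>o\<^sub>p B"
    and "0 < \<alpha>"
  shows "op_powr A \<alpha> \<le>\<^sub>o\<^sub>p op_powr B \<alpha>"
proof -
  \<comment> \<open>The interval from 0 to \<open>M\<close> contains both real spectra, so a single
    sequence of polynomials serves \<open>A\<close> and \<open>B\<close> and can be compared term by
    term.\<close>
  define M where "M = max (norm A) (norm B)"
  note sa = positive_op_imp_selfadjoint[OF assms(1,3)] positive_op_imp_selfadjoint[OF assms(2,4)]
  have "\<exists>p. (\<exists>r. pderiv p = r * r) \<and> (\<forall>t\<in>{0..M}. \<bar>poly p t - t powr \<alpha>\<bar> < 1 / real (Suc n))" for n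
    using powr_approximation_pderiv_square[OF assms(7), of "1 / real (Suc n)" M]
    by (metis of_nat_0_less_iff zero_less_Suc zero_less_divide_1_iff)
  then obtain p where sq: "\<And>n. \<exists>r. pderiv (p n) = r * r"
    and p: "\<And>n t. t \<in> {0..M} \<Longrightarrow> \<bar>poly (p n) t - t powr \<alpha>\<bar> < 1 / real (Suc n)"
    by metis
  have "uniform_limit {0..M} (\<lambda>n. poly (p n)) (\<lambda>t. t powr \<alpha>) sequentially"
  proof (rule uniform_limitI)
    fix e :: real
    assume "e > 0"
    then have "\<forall>\<^sub>F n in sequentially. 1 / real (Suc n) < e"
      using order_tendstoD(2)[OF LIMSEQ_inverse_real_of_nat] by (simp add: inverse_eq_divide)
    then show "\<forall>\<^sub>F n in sequentially. \<forall>t\<in>{0..M}. dist (poly (p n) t) (t powr \<alpha>) < e"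
      by eventually_elim (use p in \<open>force simp: dist_real_def intro: less_trans\<close>)
  qed
  then have lim: "(\<lambda>n. op_poly (p n) C) \<longlonglongrightarrow> op_powr C \<alpha>"
    if "C \<in> bounded_ops" "positive_op C" "norm C \<le> M" for C :: "'a \<Rightarrow>\<^sub>L 'a"
    unfolding op_powr_def
    using positive_op_real_spectrum[OF that(1,2)] that(3)
    by (intro cont_fun_calc_LIMSEQ positive_op_imp_selfadjoint that(1,2))
      (auto elim!: uniform_limit_on_subset)
  have "positive_op (op_poly (p n) B - op_poly (p n) A)" for n
  proof (rule selfadjoint_imp_positive_op)
    show "op_poly (p n) B - op_poly (p n) A \<in> bounded_ops"
      \<comment> \<open>What \<open>metis\<close> adds is that scaling by a complex number
        distributes over a difference, derived from additivity.\<close>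
      using op_poly_complex_linear[OF assms(1), of "p n"] op_poly_complex_linear[OF assms(2), of "p n"]
      by (simp add: bounded_ops_def blinfun.diff_left)
        (metis (no_types) add_diff_cancel diff_add_cancel scaleC_add_right)
    show "selfadjoint (op_poly (p n) B - op_poly (p n) A)"
      using sa[THEN selfadjoint_op_poly, of "p n"]
      by (simp add: selfadjoint_def blinfun.diff_left inner_diff_left inner_diff_right)
    have "0 \<le> inner ((B - A) x) x" for x
      using assms(6) by (simp add: op_le_def positive_op_inner_nonneg)
    moreover obtain r where "pderiv (p n) = r * r" using sq by blast
    ultimately show "0 \<le> inner ((op_poly (p n) B - op_poly (p n) A) x) x" for x
      using op_poly_mono_of_pderiv_square[OF sa assms(5), of "p n" r x]
      by (simp add: blinfun.diff_left inner_diff_left)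
  qed
  moreover have "(\<lambda>n. op_poly (p n) B - op_poly (p n) A) \<longlonglongrightarrow> op_powr B \<alpha> - op_powr A \<alpha>"
    using assms(1-4) by (intro tendsto_diff lim) (simp_all add: M_def)
  ultimately show ?thesis
    unfolding op_le_def using positive_op_LIMSEQ by blast
qed

end
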